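(* Let $p$ be a prime, $\ell\ge1$, and let $f\in P_{p^\ell}$ be a nilpotent periodic sequence. If $e_\gamma$ is the leading component of its generating vector $\mathrm{vect}(f)$, then $\tau(\Sigma^sf)=\tau(\Sigma^{s+\gamma}[e_\gamma])$ for all sufficiently large $s$.
   Context: $P_{p^\ell}$ is the module of periodic sequences $\mathbb{N}\to\mathbb{Z}_{p^\ell}$, and $\tau$ denotes the (minimal) period. $\Delta f(n)=f(n+1)-f(n)$. A sequence $f$ is nilpotent if $\Delta^\eta f=0$ for some $\eta\ge1$; the minimal such $\eta$ is the nilpotency index. The generating vector is $\mathrm{vect}(f)=(e_0,\dots,e_{\eta-1})$ with $e_i=\Delta^if(0)$. The leading component is the last entry $e_\gamma$ of $\mathrm{vect}(f)$ having minimal $p$-adic valuation, where on $\mathbb{Z}_{p^\ell}$ the valuation of $0$ is $\infty$. $[c]$ is the constant sequence with value $c$. $\Sigma$ is the sum operator $\Sigma f(0)=0$, $\Sigma f(n)=f(n-1)+\Sigma f(n-1)$. *)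

theory Defs
  imports "HOL-Number_Theory.Residues" "HOL-Library.Extended_Nat"
begin

abbreviation Zpow :: "nat \<Rightarrow> nat \<Rightarrow> int ring" where
  "Zpow p l \<equiv> residue_ring (int (p ^ l))"

definition is_period :: "(nat \<Rightarrow> 'a) \<Rightarrow> nat \<Rightarrow> bool" where
  "is_period f T \<longleftrightarrow> T > 0 \<and> (\<forall>n. f (n + T) = f n)"

definition min_period :: "(nat \<Rightarrow> 'a) \<Rightarrow> nat" where
  "min_period f = (LEAST T. is_period f T)"

definition periodic_seqs :: "('a, 'b) ring_scheme \<Rightarrow> (nat \<Rightarrow> 'a) set" where
  "periodic_seqs R = {f. range f \<subseteq> carrier R \<and> (\<exists>T. is_period f T)}"

definition seq_diff :: "('a, 'b) ring_scheme \<Rightarrow> (nat \<Rightarrow> 'a) \<Rightarrow> nat \<Rightarrow> 'a" where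
  "seq_diff R f n = f (n + 1) \<ominus>\<^bsub>R\<^esub> f n"

primrec seq_sum :: "('a, 'b) ring_scheme \<Rightarrow> (nat \<Rightarrow> 'a) \<Rightarrow> nat \<Rightarrow> 'a" where
  "seq_sum R f 0 = \<zero>\<^bsub>R\<^esub>"
| "seq_sum R f (Suc n) = f n \<oplus>\<^bsub>R\<^esub> seq_sum R f n"

definition const_seq :: "'a \<Rightarrow> nat \<Rightarrow> 'a" where
  "const_seq c = (\<lambda>_. c)"

definition nilpotent_seq :: "('a, 'b) ring_scheme \<Rightarrow> (nat \<Rightarrow> 'a) \<Rightarrow> bool" where
  "nilpotent_seq R f \<longleftrightarrow> (\<exists>k\<ge>1. (seq_diff R ^^ k) f = const_seq \<zero>\<^bsub>R\<^esub>)"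

text \<open>The index is at least 1 even for the zero sequence, so generating vectors are nonempty.\<close>

definition nilpotency_index :: "('a, 'b) ring_scheme \<Rightarrow> (nat \<Rightarrow> 'a) \<Rightarrow> nat" where
  "nilpotency_index R f = (LEAST k. k \<ge> 1 \<and> (seq_diff R ^^ k) f = const_seq \<zero>\<^bsub>R\<^esub>)"

definition gen_vect :: "('a, 'b) ring_scheme \<Rightarrow> (nat \<Rightarrow> 'a) \<Rightarrow> 'a list" where
  "gen_vect R f = map (\<lambda>i. (seq_diff R ^^ i) f 0) [0..<nilpotency_index R f]"

text \<open>The valuation on the integers mod \<open>p ^ l\<close>, computed on the representative in
  \<open>{0..p ^ l - 1}\<close>; for nonzero residues it does not depend on the representative.\<close>

definition pval :: "nat \<Rightarrow> int \<Rightarrow> enat" where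
  "pval p x = (if x = 0 then \<infinity> else enat (multiplicity (int p) x))"

definition leading_index :: "nat \<Rightarrow> int list \<Rightarrow> nat" where
  "leading_index p v =
     Max {i. i < length v \<and> (\<forall>j < length v. pval p (v ! i) \<le> pval p (v ! j))}"

end

theory Submission imports Defs begin

text \<open>Newton expansion gives \<open>\<Sigma>\<^sup>s f(n) = \<Sum>m<N. e\<^sub>m * (n choose (m + s))\<close> modulo \<open>p ^ l\<close>. Let \<open>v\<close> be
  the valuation of the leading component and \<open>p ^ L \<le> s + \<gamma> < p ^ (L + 1)\<close>. As soon as \<open>N \<le> p ^ L\<close>, the
  minimal period of this sequence is \<open>p ^ (l - v + L)\<close>, a number that depends on \<open>e\<close> only
  through \<open>v\<close> and \<open>\<gamma>\<close>; the sequence \<open>\<Sigma>\<^sup>s\<^sup>+\<^sup>\<gamma> [e\<^sub>\<gamma>]\<close> has the same two parameters.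
  Since \<open>p ^ T choose j\<close> has valuation \<open>T - v\<^sub>p j\<close> for \<open>1 \<le> j \<le> p ^ T\<close>, Vandermonde's identity
  shows that \<open>p ^ (l - v + L)\<close> is a period; components after \<open>e\<^sub>\<gamma>\<close> may gain one in \<open>v\<^sub>p j\<close> but have
  valuation larger than \<open>v\<close>. For \<open>p ^ (l - v + L - 1)\<close>, taking differences until the leading
  component multiplies \<open>n choose p ^ L\<close> leaves this component as the only one that
  does not vanish.\<close>

subsection \<open>Periods\<close>

lemma is_period_mult:
  assumes "is_period f T" "k > 0"
  shows "is_period f (k * T)"
proof -
  have "f (n + k * T) = f n" for n k
  proof (induction k)
    case (Suc k)
    have "f (n + Suc k * T) = f ((n + k * T) + T)" by (simp add: algebra_simps)
    then show ?case using assms Suc by (simp add: is_period_def)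
  qed simp
  then show ?thesis using assms by (simp add: is_period_def)
qed

lemma is_period_min_period: "is_period f T \<Longrightarrow> is_period f (min_period f)"
  unfolding min_period_def by (rule LeastI)

lemma min_period_dvd:
  assumes "is_period f T"
  shows "min_period f dvd T"
proof (rule ccontr)
  let ?d = "min_period f"
  assume nd: "\<not> ?d dvd T"
  have d: "is_period f ?d" using assms by (rule is_period_min_period)
  have "f (n + T mod ?d) = f n" for n
  proof -
    have "f (k + (T div ?d) * ?d) = f k" for k
      using is_period_mult[OF d, of "T div ?d"] by (cases "T div ?d = 0") (simp_all add: is_period_def)
    then have "f (n + T mod ?d) = f (n + T mod ?d + (T div ?d) * ?d)" by (rule sym)
    also have "\<dots> = f (n + T)" by (simp add: add.assoc)
    also have "\<dots> = f n" using assms by (simp add: is_period_def)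
    finally show ?thesis .
  qed
  moreover have "T mod ?d > 0" using nd by (auto simp: dvd_eq_mod_eq_0)
  ultimately have "is_period f (T mod ?d)" by (simp add: is_period_def)
  then have "?d \<le> T mod ?d" unfolding min_period_def by (rule Least_le)
  moreover have "T mod ?d < ?d" using d by (simp add: is_period_def)
  ultimately show False by simp
qed

text \<open>A proper divisor of \<open>p ^ Suc k\<close> divides \<open>p ^ k\<close>, so
  \<open>p ^ k\<close> would be a period too. This reduces a minimal period to two checks.\<close>

lemma min_period_eq_prime_power:
  assumes "prime p" "is_period f (p ^ Suc k)" "\<not> is_period f (p ^ k)"
  shows "min_period f = p ^ Suc k"
proof -
  obtain i where i: "i \<le> Suc k" "min_period f = p ^ i"
    using min_period_dvd[OF assms(2)] divides_primepow_nat[OF assms(1)] by blast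
  have "i = Suc k"
  proof (rule ccontr)
    assume "i \<noteq> Suc k"
    then have "p ^ k = p ^ (k - i) * p ^ i" using i(1) by (simp flip: power_add)
    moreover have "is_period f (p ^ (k - i) * p ^ i)"
      using is_period_mult[OF is_period_min_period[OF assms(2)]] i(2) prime_gt_0_nat[OF assms(1)]
      by simp
    ultimately show False using assms(3) by simp
  qed
  then show ?thesis using i by simp
qed

subsection \<open>Binomial coefficients of prime powers\<close>

text \<open>By absorption, j * (P choose j) = P * ((P - 1) choose (j - 1)) with P =
  \<open>p ^ (k + r)\<close>. As \<open>j\<close> contains at most \<open>r\<close> factors
  \<open>p\<close>, at least \<open>k\<close> remain for the binomial.\<close>

lemma prime_power_dvd_choose:
  fixes p :: nat
  assumes "prime p" "\<not> p ^ Suc r dvd j"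
  shows "p ^ k dvd (p ^ (k + r)) choose j"
proof -
  have j: "j > 0" using assms(2) by (cases j) auto
  obtain a u where u: "j = p ^ a * u" "\<not> p dvd u"
    using j assms(1) by (metis multiplicity_decompose' not_prime_unit not_gr_zero)
  have a: "a \<le> r" using assms(2) u(1)
    by (metis dvd_mult2 le_imp_power_dvd not_less_eq_eq)
  have T: "p ^ (k + r) = p ^ a * p ^ (k + r - a)" using a by (simp flip: power_add)
  have "j * (p ^ (k + r) choose j) = p ^ (k + r) * ((p ^ (k + r) - 1) choose (j - 1))"
    using j by (intro times_binomial_minus1_eq)
  then have "p ^ a * (u * (p ^ (k + r) choose j))
      = p ^ a * (p ^ (k + r - a) * ((p ^ (k + r) - 1) choose (j - 1)))"
    by (metis T u(1) mult.assoc)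
  then have "u * (p ^ (k + r) choose j) = p ^ (k + r - a) * ((p ^ (k + r) - 1) choose (j - 1))"
    using prime_gt_0_nat[OF assms(1)] by simp
  then have "p ^ (k + r - a) dvd u * (p ^ (k + r) choose j)" by simp
  moreover have "coprime (p ^ (k + r - a)) u"
    using u(2) assms(1) by (simp add: prime_imp_coprime)
  ultimately have "p ^ (k + r - a) dvd p ^ (k + r) choose j"
    by (simp add: coprime_dvd_mult_right_iff)
  moreover have "p ^ k dvd p ^ (k + r - a)" using a by (intro le_imp_power_dvd) simp
  ultimately show ?thesis by (rule dvd_trans[rotated])
qed

text \<open>Pascal's rule: two neighbours in this row sum to an entry of row \<open>p ^ T\<close>
  that is divisible by \<open>p\<close>, so non-divisibility passes from \<open>j\<close> to
  \<open>Suc j\<close>.\<close>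

lemma prime_not_dvd_prime_power_minus_one_choose:
  fixes p :: nat
  assumes "prime p" "j < p ^ T"
  shows "\<not> p dvd (p ^ T - 1) choose j"
  using assms(2)
proof (induction j)
  case 0
  then show ?case using assms(1) by (simp add: prime_nat_iff)
next
  case (Suc j)
  obtain t where t: "T = Suc t" using Suc.prems by (cases T) auto
  have "\<not> p ^ T dvd Suc j" using Suc.prems by (auto dest: dvd_imp_le)
  then have "p ^ 1 dvd p ^ (1 + t) choose Suc j"
    using t by (intro prime_power_dvd_choose assms(1)) simp
  then have "p dvd p ^ T choose Suc j" using t by simp
  moreover have "p ^ T choose Suc j = ((p ^ T - 1) choose j) + ((p ^ T - 1) choose Suc j)"
    using Suc.prems by (cases "p ^ T") auto
  ultimately show ?case using Suc by (auto simp: dvd_add_left_iff)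
qed

text \<open>Absorption gives \<open>p ^ k\<close> times a binomial from row
  \<open>p ^ (k + r) - 1\<close>, which is prime to \<open>p\<close>.\<close>

lemma prime_power_Suc_not_dvd_choose:
  fixes p :: nat
  assumes "prime p"
  shows "\<not> p ^ Suc k dvd p ^ (k + r) choose p ^ r"
proof -
  have p: "p > 0" using assms by (rule prime_gt_0_nat)
  have "p ^ r * (p ^ (k + r) choose p ^ r) = p ^ (k + r) * ((p ^ (k + r) - 1) choose (p ^ r - 1))"
    using p by (intro times_binomial_minus1_eq) simp
  then have "p ^ r * (p ^ (k + r) choose p ^ r)
      = p ^ r * (p ^ k * ((p ^ (k + r) - 1) choose (p ^ r - 1)))"
    by (simp add: power_add mult_ac)
  then have "p ^ (k + r) choose p ^ r = p ^ k * ((p ^ (k + r) - 1) choose (p ^ r - 1))"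
    using p by simp
  moreover have "\<not> p dvd (p ^ (k + r) - 1) choose (p ^ r - 1)"
  proof (rule prime_not_dvd_prime_power_minus_one_choose[OF assms])
    have "p ^ r \<le> p ^ (k + r)" using p by (intro power_increasing) auto
    moreover have "p ^ r > 0" using p by simp
    ultimately show "p ^ r - 1 < p ^ (k + r)" by linarith
  qed
  ultimately show ?thesis using p by (simp add: mult.commute[of p])
qed

subsection \<open>Periods of Newton series\<close>

text \<open>Values stay in the integers and reduction is postponed, so that divisibility of
  binomials can be used directly.\<close>

definition newton_series :: "(nat \<Rightarrow> int) \<Rightarrow> nat \<Rightarrow> nat \<Rightarrow> nat \<Rightarrow> int" where
  "newton_series e N s n = (\<Sum>m<N. e m * int (n choose (m + s)))"

text \<open>Pascal's rule. Read one way, differencing lowers \<open>s\<close>; read the other way,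
  summation raises it.\<close>

lemma newton_series_Suc:
  "newton_series e N (Suc s) (Suc n) = newton_series e N s n + newton_series e N (Suc s) n"
  by (simp add: newton_series_def algebra_simps flip: sum.distrib)

lemma newton_series_period_diff:
  assumes "is_period (\<lambda>n. newton_series e N (r + d) n mod q) T"
  shows "is_period (\<lambda>n. newton_series e N r n mod q) T"
  using assms
proof (induction d)
  case (Suc d)
  have T: "T > 0"
    and eq: "newton_series e N (Suc (r + d)) (n + T) mod q = newton_series e N (Suc (r + d)) n mod q" for n
    using Suc.prems by (auto simp: is_period_def)
  have "newton_series e N (r + d) (n + T) mod q = newton_series e N (r + d) n mod q" for n
  proof -
    have "(newton_series e N (Suc (r + d)) (Suc n + T) - newton_series e N (Suc (r + d)) (n + T)) mod q
      = (newton_series e N (Suc (r + d)) (Suc n) - newton_series e N (Suc (r + d)) n) mod q"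
      by (intro mod_diff_cong eq)
    then show ?thesis by (simp add: newton_series_Suc)
  qed
  then show ?case using T Suc.IH by (simp add: is_period_def)
qed simp

text \<open>In Vandermonde's expansion the term j = 0 reproduces \<open>n choose (m + s)\<close>, so
  only \<open>T choose j\<close> with j \<ge> 1 enters the difference.\<close>

lemma newton_series_is_period:
  assumes "T > 0" "\<And>m j. m < N \<Longrightarrow> 1 \<le> j \<Longrightarrow> j \<le> m + s \<Longrightarrow> q dvd e m * int (T choose j)"
  shows "is_period (\<lambda>n. newton_series e N s n mod q) T"
proof -
  have "newton_series e N s (n + T) mod q = newton_series e N s n mod q" for n
  proof -
    have "q dvd e m * int ((n + T) choose (m + s)) - e m * int (n choose (m + s))"
      if m: "m < N" for m
    proof -
      have "(n + T) choose (m + s) = (\<Sum>j\<le>m + s. (T choose j) * (n choose (m + s - j)))"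
        by (subst add.commute) (rule vandermonde[symmetric])
      also have "{..m + s} = insert 0 {1..m + s}" by auto
      also have "(\<Sum>j\<in>\<dots>. (T choose j) * (n choose (m + s - j)))
        = (n choose (m + s)) + (\<Sum>j=1..m + s. (T choose j) * (n choose (m + s - j)))"
        by (subst sum.insert) auto
      finally have "e m * int ((n + T) choose (m + s)) - e m * int (n choose (m + s))
        = (\<Sum>j=1..m + s. (e m * int (T choose j)) * int (n choose (m + s - j)))"
        by (simp add: algebra_simps sum_distrib_left)
      also have "q dvd \<dots>" 
        by (rule dvd_sum, rule dvd_mult2, rule assms(2)) (use m in auto)
      finally show ?thesis .
    qed
    then have "q dvd newton_series e N s (n + T) - newton_series e N s n"
      unfolding newton_series_def sum_subtractf[symmetric] by (intro dvd_sum) auto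
    then show ?thesis by (simp add: mod_eq_dvd_iff)
  qed
  then show ?thesis using assms(1) by (simp add: is_period_def)
qed

text \<open>\<open>all\<close>, \<open>after\<close> and \<open>lead\<close> say by divisibility
  that \<open>v\<close> is the least valuation, last attained at \<gamma>. Being stated for
  arbitrary \<open>e\<close>, it applies to both sides of the theorem.\<close>

lemma newton_series_min_period:
  fixes p :: nat
  assumes p: "prime p" and "\<gamma> < N" "v < l" "N \<le> p ^ L" "p ^ L \<le> s + \<gamma>" "s + \<gamma> < p ^ Suc L"
    and all: "\<And>m. m < N \<Longrightarrow> int (p ^ v) dvd e m"
    and after: "\<And>m. \<gamma> < m \<Longrightarrow> m < N \<Longrightarrow> int (p ^ Suc v) dvd e m"
    and lead: "\<not> int (p ^ Suc v) dvd e \<gamma>"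
  shows "min_period (\<lambda>n. newton_series e N s n mod int (p ^ l)) = p ^ (l - v + L)"
proof -
  define k where "k = l - Suc v"
  have l: "l = v + Suc k" "l = Suc v + k" using assms(3) by (auto simp: k_def)
  have p0: "p > 0" and p2: "p \<ge> 2" using p by (simp_all add: prime_gt_0_nat prime_ge_2_nat)
  have "min_period (\<lambda>n. newton_series e N s n mod int (p ^ l)) = p ^ Suc (k + L)"
  proof (rule min_period_eq_prime_power[OF p])
    show "is_period (\<lambda>n. newton_series e N s n mod int (p ^ l)) (p ^ Suc (k + L))"
    proof (rule newton_series_is_period)
      show "p ^ Suc (k + L) > 0" using p0 by simp
    next
      fix m j assume m: "m < N" and j: "1 \<le> j" "j \<le> m + s"
      show "int (p ^ l) dvd e m * int (p ^ Suc (k + L) choose j)"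
      proof (cases "m \<le> \<gamma>")
        case True
        then have "\<not> p ^ Suc L dvd j" using j assms(6) by (auto dest!: dvd_imp_le)
        then have "p ^ Suc k dvd p ^ (Suc k + L) choose j" by (rule prime_power_dvd_choose[OF p])
        then have "int (p ^ v) * int (p ^ Suc k) dvd e m * int (p ^ (Suc k + L) choose j)"
          by (intro mult_dvd_mono all m) (simp only: int_dvd_int_iff)
        then show ?thesis using l(1) by (simp add: power_add mult_ac)
      next
        case False
        \<comment> \<open>Here \<open>j\<close> may be a multiple of \<open>p ^ Suc L\<close>, but
          \<open>N \<le> p ^ L\<close> keeps it below \<open>p ^ Suc (Suc L)\<close>; the extra
          factor \<open>p\<close> of \<open>e m\<close> makes up for the loss.\<close>
        have "j < p ^ L + p ^ Suc L" using m j assms(4,6) by linarith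
        also have "p ^ L + p ^ Suc L \<le> 2 * p ^ Suc L" using p0 by simp
        also have "\<dots> \<le> p * p ^ Suc L" using p2 by (rule mult_le_mono1)
        finally have "\<not> p ^ Suc (Suc L) dvd j" using j by (auto dest!: dvd_imp_le)
        then have "p ^ k dvd p ^ (k + Suc L) choose j" by (rule prime_power_dvd_choose[OF p])
        then have "int (p ^ Suc v) * int (p ^ k) dvd e m * int (p ^ (k + Suc L) choose j)"
          using False by (intro mult_dvd_mono after m) (simp_all only: int_dvd_int_iff not_le)
        then show ?thesis using l(2) by (simp add: power_add mult_ac)
      qed
    qed
  next
    show "\<not> is_period (\<lambda>n. newton_series e N s n mod int (p ^ l)) (p ^ (k + L))"
    proof
      \<comment> \<open>This shift puts the leading component at \<open>n choose p ^ L\<close>. It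
        is positive since \<gamma> < N \<le> p ^ L, and at most \<open>s\<close>.\<close>
      define r where "r = p ^ L - \<gamma>"
      have r: "r + (s - r) = s" "r > 0" "\<gamma> + r = p ^ L" using assms(2,4,5) by (auto simp: r_def)
      assume "is_period (\<lambda>n. newton_series e N s n mod int (p ^ l)) (p ^ (k + L))"
      then have "is_period (\<lambda>n. newton_series e N r n mod int (p ^ l)) (p ^ (k + L))"
        using newton_series_period_diff[of e N r "s - r"] r(1) by simp
      then have "newton_series e N r (0 + p ^ (k + L)) mod int (p ^ l)
          = newton_series e N r 0 mod int (p ^ l)"
        unfolding is_period_def by blast
      moreover have "newton_series e N r 0 = 0" using r(2) by (simp add: newton_series_def binomial_eq_0)
      ultimately have "int (p ^ l) dvd newton_series e N r (p ^ (k + L))" by auto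
      also have "newton_series e N r (p ^ (k + L)) = e \<gamma> * int (p ^ (k + L) choose p ^ L)
          + (\<Sum>m\<in>{..<N} - {\<gamma>}. e m * int (p ^ (k + L) choose (m + r)))"
        unfolding newton_series_def using assms(2) r(3) by (subst sum.remove[of _ \<gamma>]) auto
      finally have sum: "int (p ^ l) dvd \<dots>" .
      have "int (p ^ l) dvd (\<Sum>m\<in>{..<N} - {\<gamma>}. e m * int (p ^ (k + L) choose (m + r)))"
      proof (rule dvd_sum)
        fix m assume m: "m \<in> {..<N} - {\<gamma>}"
        \<comment> \<open>\<open>m + r\<close> lies strictly between 0 and 2 * p ^ L and differs
          from \<open>p ^ L\<close>, so every other binomial is divisible by
          \<open>p ^ Suc k\<close>, one power beyond the leading one.\<close>
        have nd: "\<not> p ^ L dvd m + r"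
        proof
          assume "p ^ L dvd m + r"
          then obtain c where c: "m + r = p ^ L * c" ..
          have "m + r < p ^ L * 2" "m + r > 0" "m + r \<noteq> p ^ L" using m assms(4) r by auto
          then have "c < 2" "c > 0" "c \<noteq> 1" using c by auto
          then show False by simp
        qed
        then obtain L' where L': "L = Suc L'" by (cases L) auto
        have "p ^ Suc k dvd p ^ (Suc k + L') choose (m + r)"
          using nd unfolding L' by (rule prime_power_dvd_choose[OF p])
        then have "int (p ^ v) * int (p ^ Suc k) dvd e m * int (p ^ (Suc k + L') choose (m + r))"
          using m by (intro mult_dvd_mono all) (simp_all only: int_dvd_int_iff, simp)
        then show "int (p ^ l) dvd e m * int (p ^ (k + L) choose (m + r))"
          using l(1) L' by (simp add: power_add mult_ac)
      qed
      with sum have lead_dvd: "int (p ^ l) dvd e \<gamma> * int (p ^ (k + L) choose p ^ L)"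
        by (simp add: dvd_add_left_iff)
      \<comment> \<open>The leading binomial has valuation exactly \<open>k\<close>; cancelling
        \<open>p ^ k\<close> and the cofactor \<open>w\<close> leaves \<open>p ^ Suc v\<close>
        dividing \<open>e \<gamma>\<close>, against \<open>lead\<close>.\<close>
      have "p ^ k dvd p ^ (k + L) choose p ^ L"
        using p2 by (intro prime_power_dvd_choose[OF p]) (auto dest!: dvd_imp_le)
      then obtain w where w: "p ^ (k + L) choose p ^ L = p ^ k * w" ..
      have "\<not> p dvd w"
        using prime_power_Suc_not_dvd_choose[OF p, of k L] p0 unfolding w by (simp add: mult.commute[of p])
      then have "coprime (int (p ^ Suc v)) (int w)"
        using p by (simp add: prime_imp_coprime del: of_nat_power)
      moreover have "int (p ^ k) * int (p ^ Suc v) dvd int (p ^ k) * (e \<gamma> * int w)"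
        using lead_dvd unfolding w l(2) by (simp add: power_add mult_ac)
      then have "int (p ^ Suc v) dvd e \<gamma> * int w" using p0 by simp
      ultimately have "int (p ^ Suc v) dvd e \<gamma>" by (simp add: coprime_dvd_mult_left_iff)
      then show False using lead by simp
    qed
  qed
  then show ?thesis using l by simp
qed

subsection \<open>Sequences over residue rings\<close>

context residues
begin

lemma seq_diff_residue: "seq_diff R f n = (f (n + 1) - f n) mod m"
  by (simp add: seq_diff_def a_minus_def res_neg_eq res_add_eq mod_simps)

lemma carrier_mod_eq: "x \<in> carrier R \<Longrightarrow> x mod m = x"
  by (simp add: res_carrier_eq)

lemma seq_diff_in_carrier: "seq_diff R f n \<in> carrier R"
  using m_gt_one by (simp add: seq_diff_residue res_carrier_eq)

text \<open>Induction on \<open>n\<close> for all \<open>f\<close> at once: f(n+1) = f(n) +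
  \<Delta>f(n), and \<Delta>f satisfies the same hypotheses with coefficients shifted by
  one.\<close>

lemma newton_expansion:
  assumes "range f \<subseteq> carrier R" "(seq_diff R ^^ N) f = const_seq \<zero>"
  shows "f n = newton_series (\<lambda>i. (seq_diff R ^^ i) f 0) N 0 n mod m"
  using assms
proof (induction n arbitrary: f)
  case 0
  show ?case
  proof (cases N)
    case 0
    then show ?thesis using "0.prems"(2) by (simp add: newton_series_def const_seq_def res_zero_eq)
  next
    case (Suc N')
    have "f 0 mod m = f 0" using "0.prems"(1) by (intro carrier_mod_eq) auto
    then show ?thesis unfolding newton_series_def Suc sum.lessThan_Suc_shift by simp
  qed
next
  case (Suc n)
  let ?e = "\<lambda>i. (seq_diff R ^^ i) f 0"
  let ?S = "\<lambda>e. newton_series e N 0 n"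
  have "(seq_diff R ^^ N) (seq_diff R f) = seq_diff R ((seq_diff R ^^ N) f)"
    by (simp flip: funpow_swap1)
  also have "\<dots> = const_seq \<zero>"
    unfolding Suc.prems(2) by (rule ext) (simp add: seq_diff_residue const_seq_def res_zero_eq)
  finally have "seq_diff R f n = newton_series (\<lambda>i. (seq_diff R ^^ i) (seq_diff R f) 0) N 0 n mod m"
    by (intro Suc.IH) (auto simp: seq_diff_in_carrier)
  then have d: "seq_diff R f n = ?S (\<lambda>i. ?e (Suc i)) mod m" by (simp add: funpow_swap1)
  have f: "f n = ?S ?e mod m" by (rule Suc.IH[OF Suc.prems])
  have eN: "?e N = 0" using Suc.prems(2) by (simp add: const_seq_def res_zero_eq)
  \<comment> \<open>Truncation at \<open>N\<close> leaves one boundary term in Pascal's rule, which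
    \<open>eN\<close> removes. The \<open>of_bool\<close> covers \<open>N = 0\<close>, where
    \<open>N - 1\<close> is truncated.\<close>
  have step: "newton_series e N 0 (Suc n) + e N * int (n choose (N - 1)) * of_bool (N > 0)
      = ?S e + ?S (\<lambda>i. e (Suc i))" for e
  proof (induction N)
    case (Suc N)
    then show ?case by (cases N) (simp_all add: newton_series_def algebra_simps)
  qed (simp add: newton_series_def)
  have "f (Suc n) = f (Suc n) mod m"
    using Suc.prems(1) by (intro carrier_mod_eq[symmetric]) auto
  also have "\<dots> = (f n + seq_diff R f n) mod m" by (simp add: seq_diff_residue mod_simps)
  also have "\<dots> = (?S ?e + ?S (\<lambda>i. ?e (Suc i))) mod m" by (subst d, subst f) (simp add: mod_simps)
  also have "?S ?e + ?S (\<lambda>i. ?e (Suc i)) = newton_series ?e N 0 (Suc n)"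
    using step[of ?e] eN by simp
  finally show ?case .
qed

text \<open>At \<open>n = 0\<close> all binomials with lower index at least \<open>Suc s\<close>
  vanish, which matches the start value of \<open>seq_sum\<close>.\<close>

lemma seq_sum_newton_series:
  assumes "\<And>n. f n = newton_series e N s n mod m"
  shows "seq_sum R f n = newton_series e N (Suc s) n mod m"
proof (induction n)
  case 0
  then show ?case by (simp add: newton_series_def res_zero_eq)
next
  case (Suc n)
  then show ?case by (simp add: assms newton_series_Suc res_add_eq mod_simps)
qed

lemma seq_sum_funpow_newton_series:
  assumes "\<And>n. f n = newton_series e N 0 n mod m"
  shows "(seq_sum R ^^ s) f n = newton_series e N s n mod m"
proof (induction s arbitrary: n)
  case 0
  then show ?case using assms by simp
next
  case (Suc s)
  then show ?case by (simp add: seq_sum_newton_series)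
qed

end

section \<open>Leading components and the comparison of the two iterated sums\<close>

text \<open>Padding with zeros gives the iterated sums of a constant the same \<open>N\<close> and
  \<open>s\<close> as those of \<open>f\<close>.\<close>

lemma newton_series_single:
  assumes "\<gamma> < N"
  shows "newton_series (\<lambda>i. if i = \<gamma> then c else 0) N s = newton_series (\<lambda>_. c) 1 (s + \<gamma>)"
  using assms by (auto simp: newton_series_def if_distrib if_distribR sum.delta add.commute cong: if_cong)

text \<open>A minimiser exists, so \<open>Max\<close> is taken over a nonempty set; a later index of
  equal valuation would belong to that set and exceed its maximum.\<close>

lemma leading_index_props:
  assumes "v \<noteq> []"
  shows "leading_index p v < length v"
    and "j < length v \<Longrightarrow> pval p (v ! leading_index p v) \<le> pval p (v ! j)"
    and "leading_index p v < j \<Longrightarrow> j < length v \<Longrightarrow> pval p (v ! leading_index p v) < pval p (v ! j)"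
proof -
  let ?M = "{i. i < length v \<and> (\<forall>j < length v. pval p (v ! i) \<le> pval p (v ! j))}"
  have fin: "finite ?M" by simp
  have "arg_min_on (\<lambda>i. pval p (v ! i)) {..<length v} \<in> ?M"
    using assms arg_min_if_finite(1)[of "{..<length v}" "\<lambda>i. pval p (v ! i)"]
      arg_min_least[of "{..<length v}" _ "\<lambda>i. pval p (v ! i)"] by fastforce
  then have ne: "?M \<noteq> {}" by blast
  have mem: "leading_index p v \<in> ?M" unfolding leading_index_def by (rule Max_in[OF fin ne])
  then show "leading_index p v < length v"
    and "j < length v \<Longrightarrow> pval p (v ! leading_index p v) \<le> pval p (v ! j)" for j by auto
  show "pval p (v ! leading_index p v) < pval p (v ! j)" if j: "leading_index p v < j" "j < length v"
  proof (rule ccontr)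
    assume "\<not> ?thesis"
    then have "j \<in> ?M" using mem j by (auto simp: not_less intro: order_trans)
    then have "j \<le> leading_index p v" unfolding leading_index_def by (rule Max_ge[OF fin])
    then show False using j by simp
  qed
qed

text \<open>Trading valuations for divisibility absorbs the case \<open>x = 0\<close>, where both
  sides hold for every \<open>k\<close>.\<close>

lemma enat_le_pval_iff:
  assumes "prime p"
  shows "enat k \<le> pval p x \<longleftrightarrow> int (p ^ k) dvd x"
  proof (cases "x = 0")
  case False
  have "\<not> is_unit (int p)" using assms by (auto simp: prime_nat_iff)
  with False show ?thesis
    by (auto simp: pval_def intro: multiplicity_dvd' multiplicity_geI)
qed (simp add: pval_def)

theorem theorem3p5:
  fixes p l \<gamma> :: nat and f :: "nat \<Rightarrow> int"
  assumes "prime p" and "l \<ge> 1"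
    and "f \<in> periodic_seqs (Zpow p l)"
    and "nilpotent_seq (Zpow p l) f"
    and "\<gamma> = leading_index p (gen_vect (Zpow p l) f)"
  shows "\<forall>\<^sub>F s in sequentially.
           min_period ((seq_sum (Zpow p l) ^^ s) f) =
           min_period ((seq_sum (Zpow p l) ^^ (s + \<gamma>)) (const_seq (gen_vect (Zpow p l) f ! \<gamma>)))"
proof -
  let ?R = "Zpow p l"
  define q where "q = int (p ^ l)"
  have p2: "p \<ge> 2" using assms(1) by (rule prime_ge_2_nat)
  have "1 < p ^ l" using p2 assms(2) by (intro one_less_power) auto
  then interpret residues q ?R by unfold_locales (simp_all add: q_def del: of_nat_power)
  define N where "N = nilpotency_index ?R f"
  define e where "e = (\<lambda>i. (seq_diff ?R ^^ i) f 0)"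
  define e' where "e' = (\<lambda>i. if i = \<gamma> then e \<gamma> else 0)"
  have N: "N \<ge> 1" "(seq_diff ?R ^^ N) f = const_seq \<zero>\<^bsub>?R\<^esub>"
    using assms(4) LeastI_ex[of "\<lambda>k. k \<ge> 1 \<and> (seq_diff ?R ^^ k) f = const_seq \<zero>\<^bsub>?R\<^esub>"]
    by (auto simp: nilpotent_seq_def N_def nilpotency_index_def)
  have range: "range f \<subseteq> carrier ?R" using assms(3) by (simp add: periodic_seqs_def)
  have len: "length (gen_vect ?R f) = N" by (simp add: gen_vect_def N_def)
  then have ne: "gen_vect ?R f \<noteq> []" using N(1) by auto
  have nth: "gen_vect ?R f ! i = e i" if "i < N" for i
    using that by (simp add: gen_vect_def N_def e_def)
  have g: "\<gamma> < N" using leading_index_props(1)[OF ne] len assms(5) by simp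
  have min: "pval p (e \<gamma>) \<le> pval p (e j)" if "j < N" for j
    using leading_index_props(2)[OF ne, of j p] that len assms(5) nth g by simp
  have after: "pval p (e \<gamma>) < pval p (e j)" if "\<gamma> < j" "j < N" for j
    using leading_index_props(3)[OF ne, of p j] that len assms(5) nth g by simp
  have sum_f: "(seq_sum ?R ^^ s) f = (\<lambda>n. newton_series e N s n mod q)" for s
    using seq_sum_funpow_newton_series[OF newton_expansion[OF range N(2)]] by (auto simp: e_def)
  have e_range: "0 \<le> e i" "e i < q" for i
  proof -
    have "e i \<in> carrier ?R" unfolding e_def using range seq_diff_in_carrier
      by (cases i) auto
    then show "0 \<le> e i" "e i < q" unfolding res_carrier_eq by simp_all
  qed
  \<comment> \<open>The component is already reduced modulo \<open>q\<close>, so the constant is its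
    own one-term Newton series.\<close>
  from e_range have "const_seq (e \<gamma>) n = newton_series (\<lambda>_. e \<gamma>) 1 0 n mod q" for n
    by (simp add: const_seq_def newton_series_def)
  then have sum_const: "(seq_sum ?R ^^ (s + \<gamma>)) (const_seq (e \<gamma>)) = (\<lambda>n. newton_series e' N s n mod q)" for s
    using seq_sum_funpow_newton_series newton_series_single[OF g, of "e \<gamma>" s]
    by (auto simp: e'_def)
  \<comment> \<open>With \<open>s + \<gamma> < p ^ (L + 1)\<close> the threshold forces N \<le> L,
    hence N < 2 ^ L \<le> p ^ L, as \<open>newton_series_min_period\<close> requires.\<close>
  have main: "min_period (\<lambda>n. newton_series e N s n mod q) = min_period (\<lambda>n. newton_series e' N s n mod q)"
    if s: "s \<ge> p ^ N" for s
  proof (cases "e \<gamma> = 0")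
    \<comment> \<open>The least valuation is infinite, so all components vanish.\<close>
    case True
    then have "e j = 0" if "j < N" for j
      using min[OF that] by (simp add: pval_def split: if_splits)
    then have "newton_series e N s = newton_series e' N s"
      using True unfolding newton_series_def e'_def by (intro ext sum.cong) auto
    then show ?thesis by simp
  next
    case False
    define v where "v = multiplicity (int p) (e \<gamma>)"
    have v: "pval p (e \<gamma>) = enat v" using False by (simp add: pval_def v_def)
    have "\<not> q dvd e \<gamma>" using False e_range[of \<gamma>] by (auto dest: zdvd_imp_le)
    then have "\<not> enat l \<le> enat v" using enat_le_pval_iff[OF assms(1), of l "e \<gamma>"] v q_def by simp
    then have vl: "v < l" by simp
    have lead: "int (p ^ v) dvd e \<gamma>" "\<not> int (p ^ Suc v) dvd e \<gamma>"
      using enat_le_pval_iff[OF assms(1), of _ "e \<gamma>"] v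
      by (metis order_refl, metis enat_ord_simps(1) Suc_n_not_le_n)
    have dvd: "int (p ^ v) dvd e j" if "j < N" for j
      using min[OF that] enat_le_pval_iff[OF assms(1), of v "e j"] v by simp
    have dvd_after: "int (p ^ Suc v) dvd e j" if "\<gamma> < j" "j < N" for j
      using after[OF that] enat_le_pval_iff[OF assms(1), of "Suc v" "e j"] v by (simp add: Suc_ile_eq)
    have "p ^ N \<ge> 1" using p2 by simp
    then have "s + \<gamma> \<ge> 1" using s by linarith
    then obtain L where L: "p ^ L \<le> s + \<gamma>" "s + \<gamma> < p ^ (L + 1)"
      using ex_power_ivl1[OF p2] by blast
    have "p ^ N < p ^ (L + 1)" using s L(2) by linarith
    then have "N < L + 1" by (rule power_less_imp_less_exp[rotated]) (use p2 in simp)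
    then have NL: "N \<le> p ^ L"
      using p2 less_exp[of L] power_mono[of 2 p L] by linarith
    have L2: "s + \<gamma> < p ^ Suc L" using L(2) by simp
    note period = newton_series_min_period[OF assms(1) g vl NL L(1) L2, folded q_def]
    have "min_period (\<lambda>n. newton_series e N s n mod q) = p ^ (l - v + L)"
      by (rule period) (use dvd dvd_after lead(2) in \<open>assumption | blast\<close>)+
    moreover have "min_period (\<lambda>n. newton_series e' N s n mod q) = p ^ (l - v + L)"
      by (rule period) (use lead in \<open>simp_all add: e'_def\<close>)
    ultimately show ?thesis by simp
  qed
  show ?thesis
    unfolding eventually_sequentially nth[OF g] sum_f sum_const using main by blast
qed

end
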